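(* Let $m,n,p$ be non-negative integers, $A\in\mathbb{R}^{m\times p}$, $B\in\mathbb{R}^{n\times p}$, $a,w\in\mathbb{R}^m$, $b\in\mathbb{R}^n$, $v\in\mathbb{R}^p$, $\underline{\varphi}\in(\mathbb{R}\cup\{-\infty\})^m$, $\overline{\varphi}\in(\mathbb{R}\cup\{\infty\})^m$, $\underline{\lambda}\in(\mathbb{R}\cup\{-\infty\})^n$, $\overline{\lambda}\in(\mathbb{R}\cup\{\infty\})^n$ with $\underline{\varphi}_i<\overline{\varphi}_i$ for all $i\in[m]$ and $\underline{\lambda}_i<\overline{\lambda}_i$ for all $i\in[n]$. Consider the problem of minimizing, over $\varphi\in\mathbb{R}^m$ and $\lambda\in\mathbb{R}^n$, the function $$F(\varphi,\lambda)=\sum_{i=1}^m\max\{w_i-\varphi_i,0\}+a^T\varphi+b^T\lambda+\sum_{j=1}^p\max\{v_j+A_{:j}^T\varphi+B_{:j}^T\lambda,0\}$$ subject to $\underline{\varphi}_i\le\varphi_i\le\overline{\varphi}_i$ for all $i\in[m]$ and $\underline{\lambda}_i\le\lambda_i\le\overline{\lambda}_i$ for all $i\in[n]$. Suppose that (i) the matrices $A$ and $B$ contain only values from the set $\{-1,0,1\}$ and each contains at most two non-zero elements per row; (ii) the vector $a$ contains only elements from the set $(-\infty,-2]\cup\{-1,0,1,2\}\cup[3,\infty)$; (iii) the vector $b$ contains only elements from the set $(-\infty,-2]\cup\{-1,0,1\}\cup[2,\infty)$. Then any interior local minimum $(\varphi,\lambda)$ of this problem with respect to individual coordinates is a global minimum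 of the problem.
   Context: Notation: $[k]=\{1,\dots,k\}$; $A_{:j}$ denotes the $j$-th column of $A$ (and similarly for $B$), so $A_{:j}^T\varphi=\sum_{i=1}^m A_{ij}\varphi_i$. Interior local minimum: let $f:X\to\mathbb{R}$ be a convex function on a closed convex set $X\subseteq\mathbb{R}^N$, extended to $\bar f:\mathbb{R}^N\to\mathbb{R}\cup\{\infty\}$ by $\bar f(x)=f(x)$ for $x\in X$ and $\bar f(x)=\infty$ for $x\notin X$. A point $x\in X$ is an interior local minimum of $f$ on $X$ with respect to individual coordinates if for all $i\in[N]$, $$x_i\in\mathrm{ri}\,\mathop{\mathrm{argmin}}_{y\in\mathbb{R}}\bar f(x_1,\dots,x_{i-1},y,x_{i+1},\dots,x_N),$$ where $\mathrm{ri}\,Y$ is the relative interior of the convex set $Y$ (the relative interior of a singleton is the singleton itself; the relative interior of a non-degenerate interval is its interior). Here $N=m+n$, $f=F$, $x=(\varphi,\lambda)$, and $X$ is the box given by the constraints. *)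

theory Defs
  imports
    "HOL-Library.Extended_Real"
    "HOL-Analysis.Convex_Euclidean_Space"
    "Jordan_Normal_Form.Matrix"
begin

no_notation inner (infix "\<bullet>" 70)

definition extended :: "real vec set \<Rightarrow> (real vec \<Rightarrow> real) \<Rightarrow> real vec \<Rightarrow> ereal" where
  "extended X f x = (if x \<in> X then ereal (f x) else \<infinity>)"

definition argmin_set :: "('a \<Rightarrow> 'b :: ord) \<Rightarrow> 'a set" where
  "argmin_set g = {y. is_arg_min g (\<lambda>_. True) y}"

text \<open>Only the defining condition is recorded here; that \<open>f\<close> is convex and that \<open>X\<close> is closed
  and convex is left to the applications.\<close>

definition interior_local_min ::
  "nat \<Rightarrow> real vec set \<Rightarrow> (real vec \<Rightarrow> real) \<Rightarrow> real vec \<Rightarrow> bool" where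
  "interior_local_min N X f x \<longleftrightarrow> X \<subseteq> carrier_vec N \<and> x \<in> X \<and>
     (\<forall>i<N. x $ i \<in> rel_interior (argmin_set (\<lambda>y. extended X f (x |\<^sub>v i \<mapsto> y))))"

definition objective ::
  "nat \<Rightarrow> nat \<Rightarrow> nat \<Rightarrow> real mat \<Rightarrow> real mat \<Rightarrow> real vec \<Rightarrow> real vec \<Rightarrow> real vec \<Rightarrow> real vec
     \<Rightarrow> real vec \<Rightarrow> real vec \<Rightarrow> real" where
  "objective m n p A B a w b v phi lam =
     (\<Sum>i<m. max (w $ i - phi $ i) 0) + a \<bullet> phi + b \<bullet> lam
     + (\<Sum>j<p. max (v $ j + col A j \<bullet> phi + col B j \<bullet> lam) 0)"

text \<open>The objective as a function of the concatenated vector in dimension \<open>m + n\<close>.\<close>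

definition joint_objective ::
  "nat \<Rightarrow> nat \<Rightarrow> nat \<Rightarrow> real mat \<Rightarrow> real mat \<Rightarrow> real vec \<Rightarrow> real vec \<Rightarrow> real vec \<Rightarrow> real vec
     \<Rightarrow> real vec \<Rightarrow> real" where
  "joint_objective m n p A B a w b v x =
     objective m n p A B a w b v (vec_first x m) (vec_last x n)"

definition in_bounds :: "nat \<Rightarrow> ereal vec \<Rightarrow> ereal vec \<Rightarrow> real vec \<Rightarrow> bool" where
  "in_bounds k lo up x \<longleftrightarrow>
     x \<in> carrier_vec k \<and> (\<forall>i<k. lo $ i \<le> ereal (x $ i) \<and> ereal (x $ i) \<le> up $ i)"

definition feasible ::
  "nat \<Rightarrow> nat \<Rightarrow> ereal vec \<Rightarrow> ereal vec \<Rightarrow> ereal vec \<Rightarrow> ereal vec \<Rightarrow> real vec set" where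
  "feasible m n lo_phi up_phi lo_lam up_lam =
     {phi @\<^sub>v lam | phi lam. in_bounds m lo_phi up_phi phi \<and> in_bounds n lo_lam up_lam lam}"

end

theory Submission
  imports Defs
begin

text \<open>Let \<open>t\<^sub>j\<close> be the argument of the \<open>j\<close>-th hinge term at the given point. Optimality is
  certified by a subgradient: pick a weight from the subdifferential of \<open>max t 0\<close> at each
  \<open>t = t\<^sub>j\<close>, namely \<open>1\<close>, \<open>1/2\<close> or \<open>0\<close> according to the sign of \<open>t\<^sub>j\<close>. Along one
  coordinate the left and right slopes \<open>L \<le> R \<le> L + 2\<close> are integers (or the function is
  monotone), and membership in the relative interior of the argmin excludes a zero slope
  on just one side. So at a point between the bounds \<open>(L, R)\<close> is \<open>(0, 0)\<close> or \<open>(-1, 1)\<close>, and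
  the weights \<open>1/2\<close> produce the slope \<open>(L + R) / 2 = 0\<close>. For a coordinate of \<open>\<phi>\<close> the
  spread may be \<open>3\<close>, but the weight of \<open>max (w\<^sub>i - \<phi>\<^sub>i) 0\<close> enters only the equation of
  coordinate \<open>i\<close>, so it can be chosen freely in its subdifferential to repair the slope.\<close>

section \<open>Subdifferential and one-sided derivatives of a single hinge term\<close>

definition subgrad_pos :: "real \<Rightarrow> real set" where
  "subgrad_pos t = (if t > 0 then {1} else if t < 0 then {0} else {0..1})"

definition dirderiv_pos :: "real \<Rightarrow> real \<Rightarrow> real" where
  "dirderiv_pos t s = (if t > 0 then s else if t < 0 then 0 else max s 0)"

text \<open>A hinge term shared by several coordinates must carry the same weight in all their
  stationarity conditions, so the value at the kink may not depend on the coordinate;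
  \<open>1/2\<close> averages the two one-sided slopes whatever the coefficient.\<close>

definition mid_subgrad :: "real \<Rightarrow> real" where
  "mid_subgrad t = (if t > 0 then 1 else if t < 0 then 0 else 1/2)"

lemma mid_subgrad_in: "mid_subgrad t \<in> subgrad_pos t"
  by (auto simp: mid_subgrad_def subgrad_pos_def)

lemma subgrad_pos_ineq:
  assumes "q \<in> subgrad_pos t"
  shows "max t 0 + q * (t' - t) \<le> max t' 0"
proof (cases "t = 0")
  case True
  then have q: "0 \<le> q" "q \<le> 1" using assms by (auto simp: subgrad_pos_def)
  have "q * t' \<le> max t' 0"
  proof (cases "t' \<ge> 0")
    case True
    then show ?thesis using mult_right_mono[OF q(2), of t'] by simp
  next
    case False
    then show ?thesis using q(1) by (simp add: mult_nonneg_nonpos)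
  qed
  then show ?thesis using True by simp
next
  case False
  then show ?thesis using assms by (auto simp: subgrad_pos_def split: if_splits)
qed

text \<open>The equality is exact, not only first order: for small \<open>d > 0\<close> the sign of
  a non-zero \<open>t\<close> persists, and at \<open>t = 0\<close> the hinge is positively
  homogeneous.\<close>

lemma eventually_dirderiv_pos:
  "\<forall>\<^sub>F d in at_right 0. max (t + s * d) 0 = max t 0 + dirderiv_pos t s * d"
proof (cases "t = 0")
  case True
  have "\<forall>\<^sub>F d in at_right 0. d > (0::real)" by (rule eventually_at_right_less)
  then show ?thesis
    by eventually_elim
      (use True in \<open>auto simp: dirderiv_pos_def max_def zero_le_mult_iff mult_le_0_iff not_le\<close>)
next
  case False
  have lim: "((\<lambda>d. t + s * d) \<longlongrightarrow> t + s * 0) (at_right 0)"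
    by (intro tendsto_intros)
  show ?thesis
  proof (cases "t > 0")
    case True
    then have "\<forall>\<^sub>F d in at_right 0. t + s * d > 0"
      using order_tendstoD(1)[OF lim, of 0] by simp
    then show ?thesis by eventually_elim (use True in \<open>simp add: dirderiv_pos_def\<close>)
  next
    case f: False
    then have "\<forall>\<^sub>F d in at_right 0. t + s * d < 0"
      using False order_tendstoD(2)[OF lim, of 0] by simp
    then show ?thesis by eventually_elim (use f False in \<open>simp add: dirderiv_pos_def\<close>)
  qed
qed

section \<open>One-sided slopes along one coordinate at a relative interior minimum\<close>

definition dir_slope :: "'j set \<Rightarrow> real \<Rightarrow> ('j \<Rightarrow> real) \<Rightarrow> ('j \<Rightarrow> real) \<Rightarrow> real \<Rightarrow> real" where
  "dir_slope J c t s \<sigma> = \<sigma> * c + (\<Sum>j\<in>J. dirderiv_pos (t j) (\<sigma> * s j))"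

lemma eventually_dir_slope:
  assumes "finite J"
    and g: "\<And>d. g (x + d) = gx + c * d + (\<Sum>j\<in>J. max (t j + s j * d) 0)"
  shows "\<forall>\<^sub>F d in at_right 0. g (x + \<sigma> * d) = g x + dir_slope J c t s \<sigma> * d"
proof -
  have "\<forall>\<^sub>F d in at_right 0. \<forall>j\<in>J.
      max (t j + (\<sigma> * s j) * d) 0 = max (t j) 0 + dirderiv_pos (t j) (\<sigma> * s j) * d"
    using assms(1) by (intro eventually_ball_finite ballI eventually_dirderiv_pos)
  then show ?thesis
  proof eventually_elim
    case (elim d)
    have "g (x + \<sigma> * d) = gx + c * (\<sigma> * d) + (\<Sum>j\<in>J. max (t j + (\<sigma> * s j) * d) 0)"
      unfolding g by (simp add: mult_ac)
    also have "\<dots> = gx + c * (\<sigma> * d)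
        + (\<Sum>j\<in>J. max (t j) 0 + dirderiv_pos (t j) (\<sigma> * s j) * d)"
      using elim by simp
    \<comment> \<open>The instance \<open>d = 0\<close> of the representation identifies the
      constant: \<open>gx\<close> is only the affine part, and \<open>g x\<close> adds the hinge
      values.\<close>
    also have "\<dots> = g x + dir_slope J c t s \<sigma> * d"
      using g[of 0] by (simp add: dir_slope_def sum.distrib sum_distrib_left distrib_left mult_ac)
    finally show ?case .
  qed
qed

text \<open>Relative interiority enters here. A zero slope makes \<open>g\<close> flat on one side,
  so the argmin is not a singleton, \<open>x\<close> lies in its ordinary interior, and the flatness
  continues past \<open>x\<close> to the other side.\<close>

lemma dir_slope_at_relative_interior_min:
  fixes X :: "real set"
  assumes fin: "finite J"
    and g: "\<And>d. g (x + d) = gx + c * d + (\<Sum>j\<in>J. max (t j + s j * d) 0)"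
    and X: "convex X"
    and x: "x \<in> rel_interior {z \<in> X. \<forall>z'\<in>X. g z \<le> g z'}"
    and \<sigma>: "\<bar>\<sigma>\<bar> = 1"
    and D: "d > 0" "x + \<sigma> * d \<in> X"
  shows "dir_slope J c t s \<sigma> \<ge> 0"
    and "dir_slope J c t s \<sigma> = 0 \<Longrightarrow> dir_slope J c t s (-\<sigma>) = 0 \<and> (\<exists>d>0. x - \<sigma> * d \<in> X)"
proof -
  let ?T = "{z \<in> X. \<forall>z'\<in>X. g z \<le> g z'}"
  have xT: "x \<in> ?T" using x rel_interior_subset by blast
  have inX: "x + \<sigma> * e \<in> X" if "0 < e" "e < d" for e
  proof -
    have "(1 - e/d) *\<^sub>R x + (e/d) *\<^sub>R (x + \<sigma> * d) \<in> X"
      using that D xT by (intro convexD[OF X]) auto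
    also have "(1 - e/d) *\<^sub>R x + (e/d) *\<^sub>R (x + \<sigma> * d) = x + \<sigma> * e"
      using D(1) by (simp add: field_simps)
    finally show ?thesis .
  qed
  \<comment> \<open>One \<open>e\<close> is needed that both stays inside \<open>X\<close> and is
    small enough for the slope formula to be exact.\<close>
  have "\<forall>\<^sub>F e in at_right 0.
      e \<in> {0<..<d} \<and> g (x + \<sigma> * e) = g x + dir_slope J c t s \<sigma> * e"
    by (intro eventually_conj eventually_at_right_real D(1) eventually_dir_slope[OF fin g])
  from eventually_happens'[OF trivial_limit_at_right_real this]
  obtain e where e: "0 < e" "e < d" "g (x + \<sigma> * e) = g x + dir_slope J c t s \<sigma> * e"
    by auto
  have "g x \<le> g (x + \<sigma> * e)" using xT inX[OF e(1,2)] by blast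
  then show "dir_slope J c t s \<sigma> \<ge> 0" using e by (simp add: zero_le_mult_iff)
  assume 0: "dir_slope J c t s \<sigma> = 0"
  then have xe: "x + \<sigma> * e \<in> ?T" using e xT inX[OF e(1,2)] by auto
  obtain r where r: "r > 0" "ball x r \<inter> affine hull ?T \<subseteq> ?T"
    using x unfolding mem_rel_interior_ball by blast
  \<comment> \<open>Both \<open>x\<close> and \<open>x + \<sigma> * e\<close> are minimizers, so
    points on the opposite side of \<open>x\<close> are affine combinations of them, with
    coefficient \<open>- (u/e)\<close>; close to \<open>x\<close> such points are minimizers
    too.\<close>
  have left: "x + (-\<sigma>) * u \<in> ?T" if "0 < u" "u < r" for u
  proof -
    have "(1 + u/e) *\<^sub>R x + (- (u/e)) *\<^sub>R (x + \<sigma> * e) \<in> affine hull ?T"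
      by (rule mem_affine[OF affine_affine_hull hull_inc[OF xT] hull_inc[OF xe]]) simp
    also have "(1 + u/e) *\<^sub>R x + (- (u/e)) *\<^sub>R (x + \<sigma> * e) = x + (-\<sigma>) * u"
      using e(1) by (simp add: field_simps)
    finally have "x + (-\<sigma>) * u \<in> affine hull ?T" .
    moreover have "x + (-\<sigma>) * u \<in> ball x r"
      using that \<sigma> by (simp add: dist_real_def abs_mult)
    ultimately show ?thesis using r(2) by blast
  qed
  have "\<forall>\<^sub>F u in at_right 0.
      u \<in> {0<..<r} \<and> g (x + (-\<sigma>) * u) = g x + dir_slope J c t s (-\<sigma>) * u"
    by (intro eventually_conj eventually_at_right_real r(1) eventually_dir_slope[OF fin g])
  from eventually_happens'[OF trivial_limit_at_right_real this]
  obtain u where u: "0 < u" "u < r"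
      "g (x + (-\<sigma>) * u) = g x + dir_slope J c t s (-\<sigma>) * u"
    by auto
  have "x + (-\<sigma>) * u \<in> ?T" by (rule left[OF u(1,2)])
  then have "g (x + (-\<sigma>) * u) = g x" "x + (-\<sigma>) * u \<in> X"
    using xT by (auto intro!: order.antisym)
  then show "dir_slope J c t s (-\<sigma>) = 0 \<and> (\<exists>d>0. x - \<sigma> * d \<in> X)"
    using u by auto
qed

text \<open>Variational inequality: \<open>- S\<close> lies in the normal cone of \<open>X\<close>
  at \<open>x\<close>, so a non-zero \<open>S\<close> is possible only at a bound.\<close>

definition stationary :: "real set \<Rightarrow> real \<Rightarrow> real \<Rightarrow> bool" where
  "stationary X x S \<longleftrightarrow> (\<forall>z\<in>X. 0 \<le> S * (z - x))"

text \<open>\<open>L\<close> and \<open>R\<close> are the one-sided slopes at \<open>x\<close> of a convex piecewise affine function whose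
  argmin over \<open>X\<close> has \<open>x\<close> in its relative interior.\<close>

definition ri_slopes :: "real set \<Rightarrow> real \<Rightarrow> real \<Rightarrow> real \<Rightarrow> bool" where
  "ri_slopes X x L R \<longleftrightarrow>
     ((\<exists>z\<in>X. z > x) \<longrightarrow> R \<ge> 0 \<and> (R = 0 \<longrightarrow> L = 0 \<and> (\<exists>z\<in>X. z < x))) \<and>
     ((\<exists>z\<in>X. z < x) \<longrightarrow> L \<le> 0 \<and> (L = 0 \<longrightarrow> R = 0 \<and> (\<exists>z\<in>X. z > x)))"

lemma stationaryI:
  assumes "(\<exists>z\<in>X. z > x) \<Longrightarrow> S \<ge> 0" and "(\<exists>z\<in>X. z < x) \<Longrightarrow> S \<le> 0"
  shows "stationary X x S"
  unfolding stationary_def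
proof
  fix z assume z: "z \<in> X"
  consider "x < z" | "z < x" | "z = x" by linarith
  then show "0 \<le> S * (z - x)"
  proof cases
    case 1
    then show ?thesis using assms(1) z by (intro mult_nonneg_nonneg) auto
  next
    case 2
    then show ?thesis using assms(2) z by (intro mult_nonpos_nonpos) auto
  qed simp
qed

text \<open>The two directions are \<open>\<sigma> = 1\<close> and \<open>\<sigma> = -1\<close>; the
  latter yields a derivative in the leftward direction, hence the minus sign for the left
  slope.\<close>

lemma ri_slopes_dir_slope:
  fixes X :: "real set"
  assumes "finite J"
    and "\<And>d. g (x + d) = gx + c * d + (\<Sum>j\<in>J. max (t j + s j * d) 0)"
    and "convex X"
    and "x \<in> rel_interior {z \<in> X. \<forall>z'\<in>X. g z \<le> g z'}"
  shows "ri_slopes X x (- dir_slope J c t s (-1)) (dir_slope J c t s 1)"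
proof -
  note * = dir_slope_at_relative_interior_min[OF assms]
  have right: "\<exists>d>0. x + d \<in> X" if "z \<in> X" "z > x" for z
    using that by (intro exI[of _ "z - x"]) auto
  have left: "\<exists>d>0. x - d \<in> X" if "z \<in> X" "z < x" for z
    using that by (intro exI[of _ "x - z"]) auto
  have right': "\<exists>z\<in>X. z > x" if "\<exists>d>0. x + d \<in> X"
    using that by force
  have left': "\<exists>z\<in>X. z < x" if "\<exists>d>0. x - d \<in> X"
    using that by force
  show ?thesis
    unfolding ri_slopes_def
  proof (intro conjI impI; elim bexE)
    fix z assume "z \<in> X" "x < z"
    then obtain d where d: "d > 0" "x + 1 * d \<in> X" using right by auto
    show "0 \<le> dir_slope J c t s 1" using *(1)[OF _ d] by simp
    assume "dir_slope J c t s 1 = 0"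
    then show "- dir_slope J c t s (-1) = 0" "\<exists>z\<in>X. z < x"
      using *(2)[OF _ d] left' by auto
  next
    fix z assume "z \<in> X" "z < x"
    then obtain d where d: "d > 0" "x + (-1) * d \<in> X" using left by auto
    show "- dir_slope J c t s (-1) \<le> 0" using *(1)[OF _ d] by simp
    assume "- dir_slope J c t s (-1) = 0"
    then show "dir_slope J c t s 1 = 0" "\<exists>z\<in>X. z > x"
      using *(2)[OF _ d] right' by auto
  qed
qed

section \<open>From integral slopes to stationarity with weights \<open>1/2\<close>\<close>

lemma Ints_less_0D: "x \<in> \<int> \<Longrightarrow> x < 0 \<Longrightarrow> x \<le> (-1::real)"
  by (elim Ints_cases) auto

lemma Ints_greater_0D: "x \<in> \<int> \<Longrightarrow> 0 < x \<Longrightarrow> (1::real) \<le> x"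
  by (elim Ints_cases) auto

text \<open>If \<open>x\<close> can move right, either both slopes vanish or \<open>R > 0\<close>.
  In the latter case integrality gives \<open>R \<ge> 1\<close>, hence \<open>L \<ge> -1\<close> and
  a non-negative midpoint; otherwise \<open>R \<le> 0\<close> is contradictory and
  \<open>L \<ge> 0\<close> suffices. Moving left is symmetric.\<close>

lemma stationary_midpoint:
  assumes ri: "ri_slopes X x L R"
    and LR: "R \<le> L + 2" "L \<le> R"
    and int: "L \<in> \<int> \<and> R \<in> \<int> \<or> R \<le> 0 \<or> L \<ge> 0"
  shows "stationary X x ((L + R) / 2)"
proof (rule stationaryI)
  assume r: "\<exists>z\<in>X. z > x"
  then have "R > 0 \<or> L = 0 \<and> R = 0" using ri by (auto simp: ri_slopes_def)
  then show "(L + R) / 2 \<ge> 0" using int LR Ints_greater_0D[of R] by auto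
next
  assume l: "\<exists>z\<in>X. z < x"
  then have "L < 0 \<or> L = 0 \<and> R = 0" using ri by (auto simp: ri_slopes_def)
  then show "(L + R) / 2 \<le> 0" using int LR Ints_less_0D[of L] by auto
qed

text \<open>Here \<open>L\<close> and \<open>R\<close> omit a hinge with coefficient -1 that sits at
  its kink: it lowers the left slope by 1 and leaves the right slope alone. The number
  \<open>q\<close> is the weight of that hinge.\<close>

lemma exists_stationary_shift:
  assumes ri: "ri_slopes X x (L - 1) R"
    and LR: "R \<le> L + 2" "L \<le> R"
    and int: "L \<in> \<int> \<and> R \<in> \<int> \<or> R \<le> 0 \<or> L - 1 \<ge> 0"
  shows "\<exists>q\<in>{0..1}. stationary X x ((L + R) / 2 - q)"
proof -
  let ?M = "(L + R) / 2"
  have r: "?M \<ge> 0 \<and> (R \<le> 0 \<longrightarrow> False)" if "\<exists>z\<in>X. z > x"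
  proof -
    \<comment> \<open>\<open>R = 0\<close> would force \<open>L - 1 = 0\<close>, against
      \<open>L \<le> R\<close>.\<close>
    have "R > 0" using that ri LR by (auto simp: ri_slopes_def)
    then show ?thesis using int LR Ints_greater_0D[of R] by auto
  qed
  have l: "?M \<le> 1 \<and> (L - 1 \<ge> 0 \<longrightarrow> False)" if "\<exists>z\<in>X. z < x"
  proof -
    have "L - 1 < 0" using that ri LR by (auto simp: ri_slopes_def)
    then show ?thesis using int LR Ints_less_0D[of "L - 1"] by auto
  qed
  \<comment> \<open>The witness is the midpoint clamped to the unit interval. With room on both
    sides it already lies there and the slope becomes 0; with room on one side only, clamping leaves
    the admissible sign.\<close>
  have "stationary X x (?M - max 0 (min 1 ?M))"
    by (rule stationaryI) (use l r in \<open>simp_all add: max_def min_def\<close>)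
  then show ?thesis by (intro bexI[of _ "max 0 (min 1 ?M)"]) auto
qed

text \<open>All claims hold termwise before summing: a term's slopes jump by
  \<open>\<bar>s j\<bar>\<close> at its kink and by 0 elsewhere, and \<open>mid_subgrad\<close>
  averages its left and right slope.\<close>

lemma dirderiv_sum_bounds:
  fixes s t :: "'j \<Rightarrow> real"
  assumes "finite J" and s: "\<forall>j\<in>J. s j \<in> \<int>" "(\<Sum>j\<in>J. \<bar>s j\<bar>) \<le> 2"
  defines "R \<equiv> \<Sum>j\<in>J. dirderiv_pos (t j) (s j)"
    and "L \<equiv> - (\<Sum>j\<in>J. dirderiv_pos (t j) (- s j))"
  shows "L \<in> \<int>" "R \<in> \<int>" "L \<le> R" "R \<le> L + 2" "R \<le> 2" "- 2 \<le> L"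
    "(\<Sum>j\<in>J. s j * mid_subgrad (t j)) = (L + R) / 2"
proof -
  have L: "L = (\<Sum>j\<in>J. - dirderiv_pos (t j) (- s j))"
    by (simp add: L_def sum_negf)
  show "L \<in> \<int>" unfolding L
    by (intro Ints_sum Ints_minus) (auto simp: dirderiv_pos_def max_def s(1))
  show "R \<in> \<int>" unfolding R_def
    by (intro Ints_sum) (auto simp: dirderiv_pos_def max_def s(1))
  show "L \<le> R" unfolding L R_def
    by (intro sum_mono) (auto simp: dirderiv_pos_def max_def)
  have "R - L \<le> (\<Sum>j\<in>J. \<bar>s j\<bar>)" unfolding L R_def sum_subtractf[symmetric]
    by (intro sum_mono) (auto simp: dirderiv_pos_def max_def)
  then show "R \<le> L + 2" using s(2) by linarith
  have "R \<le> (\<Sum>j\<in>J. \<bar>s j\<bar>)" unfolding R_def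
    by (intro sum_mono) (auto simp: dirderiv_pos_def max_def)
  then show "R \<le> 2" using s(2) by linarith
  have "- L \<le> (\<Sum>j\<in>J. \<bar>s j\<bar>)" unfolding L sum_negf[symmetric]
    by (intro sum_mono) (auto simp: dirderiv_pos_def max_def)
  then show "- 2 \<le> L" using s(2) by linarith
  have "L + R = (\<Sum>j\<in>J. 2 * (s j * mid_subgrad (t j)))" unfolding L R_def sum.distrib[symmetric]
    by (intro sum.cong) (auto simp: dirderiv_pos_def max_def mid_subgrad_def)
  then show "(\<Sum>j\<in>J. s j * mid_subgrad (t j)) = (L + R) / 2"
    by (simp add: sum_distrib_left[symmetric])
qed

text \<open>Hinge slopes lie between -2 and 2, so \<open>c \<le> -2\<close> or
  \<open>c \<ge> 2\<close> makes the function monotone in this coordinate; any other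
  \<open>c\<close> is an integer and so are the slopes.\<close>

lemma stationary_mid_subgrad:
  assumes fin: "finite J" and s: "\<forall>j\<in>J. s j \<in> \<int>" "(\<Sum>j\<in>J. \<bar>s j\<bar>) \<le> 2"
    and c: "c \<in> \<int> \<or> c \<le> -2 \<or> c \<ge> 2"
    and ri: "ri_slopes X x (- dir_slope J c t s (-1)) (dir_slope J c t s 1)"
  shows "stationary X x (c + (\<Sum>j\<in>J. s j * mid_subgrad (t j)))"
proof -
  define R where "R = (\<Sum>j\<in>J. dirderiv_pos (t j) (s j))"
  define L where "L = - (\<Sum>j\<in>J. dirderiv_pos (t j) (- s j))"
  note b = dirderiv_sum_bounds[where t = t, OF fin s, folded R_def L_def]
  have "ri_slopes X x (c + L) (c + R)"
    using ri by (simp add: dir_slope_def L_def R_def)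
  then have "stationary X x ((c + L + (c + R)) / 2)"
    by (rule stationary_midpoint) (use b c in auto)
  then show ?thesis unfolding b(7) by (simp add: field_simps)
qed

text \<open>Adds the hinge belonging to this coordinate alone, with argument \<open>u\<close> and
  coefficient -1. It can lower the left slope to \<open>c - 3\<close>, which is why the upper
  threshold is 3 instead of 2.\<close>

lemma exists_stationary_mid_subgrad:
  assumes fin: "finite J" and s: "\<forall>j\<in>J. s j \<in> \<int>" "(\<Sum>j\<in>J. \<bar>s j\<bar>) \<le> 2"
    and c: "c \<in> \<int> \<or> c \<le> -2 \<or> c \<ge> 3"
    and ri: "ri_slopes X x (- (dir_slope J c t s (-1) + dirderiv_pos u 1))
               (dir_slope J c t s 1 + dirderiv_pos u (-1))"
  shows "\<exists>q \<in> subgrad_pos u. stationary X x (c - q + (\<Sum>j\<in>J. s j * mid_subgrad (t j)))"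
proof -
  consider "u > 0" | "u < 0" | "u = 0" by linarith
  then show ?thesis
  proof cases
    case 1
    \<comment> \<open>Locally this hinge is affine with slope -1 and is absorbed into the linear
      coefficient.\<close>
    then have "stationary X x (c - 1 + (\<Sum>j\<in>J. s j * mid_subgrad (t j)))"
      using ri c
      by (intro stationary_mid_subgrad[OF fin s])
         (auto simp: dir_slope_def dirderiv_pos_def algebra_simps)
    then show ?thesis using 1 by (simp add: subgrad_pos_def)
  next
    case 2
    then have "stationary X x (c + (\<Sum>j\<in>J. s j * mid_subgrad (t j)))"
      using ri c
      by (intro stationary_mid_subgrad[OF fin s])
         (auto simp: dirderiv_pos_def)
    then show ?thesis using 2 by (simp add: subgrad_pos_def)
  next
    case 3
    define R where "R = (\<Sum>j\<in>J. dirderiv_pos (t j) (s j))"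
    define L where "L = - (\<Sum>j\<in>J. dirderiv_pos (t j) (- s j))"
    note b = dirderiv_sum_bounds[where t = t, OF fin s, folded R_def L_def]
    have "ri_slopes X x (c + L - 1) (c + R)"
      using ri 3 by (simp add: dir_slope_def L_def R_def dirderiv_pos_def)
    then have "\<exists>q\<in>{0..1}. stationary X x ((c + L + (c + R)) / 2 - q)"
      by (rule exists_stationary_shift) (use b c in auto)
    moreover have "(c + L + (c + R)) / 2 - q = c - q + (\<Sum>j\<in>J. s j * mid_subgrad (t j))" for q
      unfolding b(7) by (simp add: field_simps)
    ultimately have "\<exists>q\<in>{0..1}. stationary X x (c - q + (\<Sum>j\<in>J. s j * mid_subgrad (t j)))"
      by (simp only:)
    then show ?thesis by (simp add: subgrad_pos_def 3)
  qed
qed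

section \<open>Optimality certificate for a sum of hinge terms over a box\<close>

definition hinge_objective ::
  "'i set \<Rightarrow> 'j set \<Rightarrow> ('i \<Rightarrow> real) \<Rightarrow> ('i \<Rightarrow> 'j \<Rightarrow> real) \<Rightarrow> ('j \<Rightarrow> real) \<Rightarrow> ('i \<Rightarrow> real) \<Rightarrow> real" where
  "hinge_objective I J c M v x =
     (\<Sum>i\<in>I. c i * x i) + (\<Sum>j\<in>J. max (v j + (\<Sum>i\<in>I. M i j * x i)) 0)"

lemma sum_fun_upd_add:
  fixes f x :: "'i \<Rightarrow> real"
  assumes "finite I" "i \<in> I"
  shows "(\<Sum>k\<in>I. f k * (x(i := x i + d)) k) = (\<Sum>k\<in>I. f k * x k) + f i * d"
  using assms by (simp add: sum.remove[of I i] distrib_left)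

lemma hinge_objective_upd:
  assumes "finite I" "i \<in> I"
  shows "hinge_objective I J c M v (x(i := x i + d)) = (\<Sum>k\<in>I. c k * x k) + c i * d
           + (\<Sum>j\<in>J. max ((v j + (\<Sum>k\<in>I. M k j * x k)) + M i j * d) 0)"
  unfolding hinge_objective_def by (simp only: sum_fun_upd_add[OF assms, where x = x and d = d] add.assoc)

text \<open>Weights \<open>q\<close> that serve all coordinates at once define a subgradient of the
  whole function. Since the constraint set is a product, the coordinatewise variational inequalities
  add up to the one for this subgradient.\<close>

lemma hinge_objective_global_min:
  assumes q: "\<And>j. j \<in> J \<Longrightarrow> q j \<in> subgrad_pos (v j + (\<Sum>i\<in>I. M i j * x i))"
    and st: "\<And>i. i \<in> I \<Longrightarrow> stationary (X i) (x i) (c i + (\<Sum>j\<in>J. M i j * q j))"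
    and z: "\<And>i. i \<in> I \<Longrightarrow> z i \<in> X i"
  shows "hinge_objective I J c M v x \<le> hinge_objective I J c M v z"
proof -
  let ?t = "\<lambda>x j. v j + (\<Sum>i\<in>I. M i j * x i)"
  have "0 \<le> (\<Sum>i\<in>I. (c i + (\<Sum>j\<in>J. M i j * q j)) * (z i - x i))"
    using st z by (intro sum_nonneg) (auto simp: stationary_def)
  also have "\<dots> = (\<Sum>i\<in>I. c i * (z i - x i)) + (\<Sum>i\<in>I. \<Sum>j\<in>J. q j * (M i j * (z i - x i)))"
    by (simp add: distrib_left sum.distrib sum_distrib_left mult_ac)
  \<comment> \<open>Exchanging the sums turns coordinate increments into increments of the hinge
    arguments.\<close>
  also have "(\<Sum>i\<in>I. \<Sum>j\<in>J. q j * (M i j * (z i - x i))) = (\<Sum>j\<in>J. q j * (?t z j - ?t x j))"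
    by (subst sum.swap) (simp add: sum_distrib_left sum_subtractf right_diff_distrib)
  finally have 1: "0 \<le> (\<Sum>i\<in>I. c i * (z i - x i)) + (\<Sum>j\<in>J. q j * (?t z j - ?t x j))" .
  have "(\<Sum>j\<in>J. max (?t x j) 0 + q j * (?t z j - ?t x j)) \<le> (\<Sum>j\<in>J. max (?t z j) 0)"
    using q by (intro sum_mono subgrad_pos_ineq)
  with 1 show ?thesis
    by (simp add: hinge_objective_def sum.distrib right_diff_distrib sum_subtractf)
qed

lemma hinge_objective_cong:
  assumes "\<And>i. i \<in> I \<Longrightarrow> x i = y i"
  shows "hinge_objective I J c M v x = hinge_objective I J c M v y"
  unfolding hinge_objective_def using assms by (simp cong: sum.cong)

lemma hinge_objective_ri_slopes:
  assumes "finite I" "finite J" "i \<in> I" "convex X"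
    and "x i \<in> rel_interior {y \<in> X. \<forall>y'\<in>X.
           hinge_objective I J c M v (x(i := y)) \<le> hinge_objective I J c M v (x(i := y'))}"
  defines "t \<equiv> \<lambda>j. v j + (\<Sum>k\<in>I. M k j * x k)"
  shows "ri_slopes X (x i) (- dir_slope J (c i) t (M i) (-1)) (dir_slope J (c i) t (M i) 1)"
  by (rule ri_slopes_dir_slope
        [where g = "\<lambda>y. hinge_objective I J c M v (x(i := y))" and gx = "\<Sum>k\<in>I. c k * x k"])
     (use assms in \<open>simp_all add: hinge_objective_upd\<close>)

section \<open>Translation of the matrix problem into hinge form\<close>

lemma sum_lessThan_add:
  fixes f :: "nat \<Rightarrow> 'a :: comm_monoid_add"
  shows "(\<Sum>i<m + n. f i) = (\<Sum>i<m. f i) + (\<Sum>i<n. f (m + i))"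
  by (induction n) (simp_all add: add_ac)

lemma sum_abs_le_card_support:
  fixes f :: "nat \<Rightarrow> real"
  assumes "\<And>j. j < p \<Longrightarrow> f j \<in> {-1, 0, 1}"
  shows "(\<Sum>j<p. \<bar>f j\<bar>) \<le> card {j. j < p \<and> f j \<noteq> 0}"
proof -
  have "(\<Sum>j<p. \<bar>f j\<bar>) = (\<Sum>j\<in>{j. j < p \<and> f j \<noteq> 0}. \<bar>f j\<bar>)"
    by (rule sum.mono_neutral_right) auto
  also have "\<dots> \<le> (\<Sum>j\<in>{j. j < p \<and> f j \<noteq> 0}. 1)"
    using assms by (intro sum_mono) fastforce
  finally show ?thesis by simp
qed

text \<open>The problem in \<open>m + n\<close> unified coordinates: the hinge term \<open>Inl k\<close> is
  \<open>max (w\<^sub>k - \<phi>\<^sub>k) 0\<close>, the term \<open>Inr j\<close> belongs to the \<open>j\<close>-th columns of \<open>A\<close> and \<open>B\<close>.\<close>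

definition stacked_entry :: "nat \<Rightarrow> 'a vec \<Rightarrow> 'a vec \<Rightarrow> nat \<Rightarrow> 'a" where
  "stacked_entry m u u' i = (if i < m then u $ i else u' $ (i - m))"

definition stacked_row :: "nat \<Rightarrow> real mat \<Rightarrow> real mat \<Rightarrow> nat \<Rightarrow> nat \<Rightarrow> real" where
  "stacked_row m A B i j = (if i < m then A $$ (i, j) else B $$ (i - m, j))"

definition hinge_coeff :: "nat \<Rightarrow> real mat \<Rightarrow> real mat \<Rightarrow> nat \<Rightarrow> nat + nat \<Rightarrow> real" where
  "hinge_coeff m A B i = case_sum (\<lambda>k. if k = i then -1 else 0) (stacked_row m A B i)"

lemma in_feasible_iff:
  "x \<in> feasible m n lo_phi up_phi lo_lam up_lam \<longleftrightarrow> x \<in> carrier_vec (m + n) \<and>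
     (\<forall>i<m + n. stacked_entry m lo_phi lo_lam i \<le> ereal (x $ i) \<and>
                ereal (x $ i) \<le> stacked_entry m up_phi up_lam i)" (is "?l \<longleftrightarrow> ?r")
proof
  assume ?l
  then obtain phi lam where x: "x = phi @\<^sub>v lam"
    and "in_bounds m lo_phi up_phi phi" "in_bounds n lo_lam up_lam lam"
    by (auto simp: feasible_def)
  then show ?r by (auto simp: in_bounds_def stacked_entry_def)
next
  assume r: ?r
  have "x = vec_first x m @\<^sub>v vec_last x n" using r by simp
  moreover have "in_bounds m lo_phi up_phi (vec_first x m)"
    unfolding in_bounds_def
  proof (intro conjI allI impI)
    fix i assume "i < m"
    then show "lo_phi $ i \<le> ereal (vec_first x m $ i)" "ereal (vec_first x m $ i) \<le> up_phi $ i"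
      using r[THEN conjunct2, rule_format, of i] by (auto simp: vec_first_def stacked_entry_def)
  qed simp
  moreover have "in_bounds n lo_lam up_lam (vec_last x n)"
    unfolding in_bounds_def
  proof (intro conjI allI impI)
    fix i assume "i < n"
    then show "lo_lam $ i \<le> ereal (vec_last x n $ i)" "ereal (vec_last x n $ i) \<le> up_lam $ i"
      using r r[THEN conjunct2, rule_format, of "m + i"]
      by (auto simp: vec_last_def stacked_entry_def)
  qed simp
  ultimately show ?l unfolding feasible_def by blast
qed

lemma joint_objective_eq_hinge_objective:
  assumes A: "A \<in> carrier_mat m p" and B: "B \<in> carrier_mat n p"
    and x: "x \<in> carrier_vec (m + n)"
  shows "joint_objective m n p A B a w b v x =
    hinge_objective {..<m + n} ({..<m} <+> {..<p}) (stacked_entry m a b) (hinge_coeff m A B)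
      (case_sum (($) w) (($) v)) (($) x)"
proof -
  have 1: "(\<Sum>i<m + n. hinge_coeff m A B i (Inl k) * x $ i) = - x $ k" if "k < m" for k
  proof -
    have "(\<Sum>i<m + n. hinge_coeff m A B i (Inl k) * x $ i)
        = (\<Sum>i<m + n. if k = i then - x $ i else 0)"
      by (intro sum.cong) (auto simp: hinge_coeff_def)
    then show ?thesis using that by simp
  qed
  have 2: "(\<Sum>i<m + n. hinge_coeff m A B i (Inr j) * x $ i)
      = col A j \<bullet> vec_first x m + col B j \<bullet> vec_last x n" if "j < p" for j
    using that A B x
    by (simp add: sum_lessThan_add hinge_coeff_def stacked_row_def scalar_prod_def
        vec_first_def vec_last_def atLeast0LessThan)
  have 3: "(\<Sum>i<m + n. stacked_entry m a b i * x $ i) = a \<bullet> vec_first x m + b \<bullet> vec_last x n"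
    using x by (simp add: sum_lessThan_add stacked_entry_def scalar_prod_def
        vec_first_def vec_last_def atLeast0LessThan)
  have 4: "(\<Sum>i<m. max (w $ i - vec_first x m $ i) 0) = (\<Sum>i<m. max (w $ i + - x $ i) 0)"
    by (intro sum.cong) (auto simp: vec_first_def)
  show ?thesis
    unfolding joint_objective_def objective_def hinge_objective_def 3 4
    by (simp add: sum.Plus 1 2 add.assoc)
qed

text \<open>The coordinate's own hinge is split off because the row bound 2 covers only the entries
  of \<open>A\<close> and \<open>B\<close>. For \<open>i \<ge> m\<close> no index
  \<open>k < m\<close> equals \<open>i\<close>, so nothing is added.\<close>

lemma dir_slope_hinge_coeff:
  "dir_slope ({..<m} <+> {..<p}) c t (hinge_coeff m A B i) \<sigma> =
     dir_slope {..<p} c (t \<circ> Inr) (stacked_row m A B i) \<sigma>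
       + (if i < m then dirderiv_pos (t (Inl i)) (- \<sigma>) else 0)"
proof -
  have "(\<Sum>k<m. dirderiv_pos (t (Inl k)) (\<sigma> * hinge_coeff m A B i (Inl k)))
      = (\<Sum>k<m. if k = i then dirderiv_pos (t (Inl k)) (- \<sigma>) else 0)"
    by (intro sum.cong) (auto simp: hinge_coeff_def dirderiv_pos_def)
  then show ?thesis
    by (simp add: dir_slope_def sum.Plus hinge_coeff_def)
qed

text \<open>The point \<open>x\<close> itself shows that \<open>Y\<close> is non-empty; otherwise
  the extended function would be constantly infinite and every real would minimize it.\<close>

lemma argmin_set_extended:
  assumes x: "x \<in> X" and i: "i < dim_vec x" and Y: "\<And>y. (x |\<^sub>v i \<mapsto> y) \<in> X \<longleftrightarrow> y \<in> Y"
  shows "argmin_set (\<lambda>y. extended X f (x |\<^sub>v i \<mapsto> y)) =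
    {y \<in> Y. \<forall>y'\<in>Y. f (x |\<^sub>v i \<mapsto> y) \<le> f (x |\<^sub>v i \<mapsto> y')}"
proof -
  have "x |\<^sub>v i \<mapsto> x $ i = x" using i by (intro eq_vecI) (auto simp: update_vec_def)
  then have ne: "x $ i \<in> Y" using x Y by metis
  then show ?thesis
    by (force simp: argmin_set_def is_arg_min_def extended_def Y not_less)
qed

section \<open>Construction of the certificate at the given point\<close>

theorem theorem1:
  fixes m n p :: nat
    and A B :: "real mat"
    and a w b v :: "real vec"
    and lo_phi up_phi lo_lam up_lam :: "ereal vec"
    and phi lam :: "real vec"
  assumes "A \<in> carrier_mat m p" and "B \<in> carrier_mat n p"
    and "a \<in> carrier_vec m" and "w \<in> carrier_vec m"
    and "b \<in> carrier_vec n" and "v \<in> carrier_vec p"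
    and "lo_phi \<in> carrier_vec m" and "up_phi \<in> carrier_vec m"
    and "lo_lam \<in> carrier_vec n" and "up_lam \<in> carrier_vec n"
    and "\<forall>i<m. lo_phi $ i \<noteq> \<infinity> \<and> up_phi $ i \<noteq> -\<infinity> \<and> lo_phi $ i < up_phi $ i"
    and "\<forall>i<n. lo_lam $ i \<noteq> \<infinity> \<and> up_lam $ i \<noteq> -\<infinity> \<and> lo_lam $ i < up_lam $ i"
    and "elements_mat A \<subseteq> {-1, 0, 1}" and "\<forall>i<m. card {j. j < p \<and> A $$ (i, j) \<noteq> 0} \<le> 2"
    and "elements_mat B \<subseteq> {-1, 0, 1}" and "\<forall>i<n. card {j. j < p \<and> B $$ (i, j) \<noteq> 0} \<le> 2"
    and "\<forall>i<m. a $ i \<in> {..-2} \<union> {-1, 0, 1, 2} \<union> {3..}"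
    and "\<forall>i<n. b $ i \<in> {..-2} \<union> {-1, 0, 1} \<union> {2..}"
    and "phi \<in> carrier_vec m" and "lam \<in> carrier_vec n"
    and "interior_local_min (m + n) (feasible m n lo_phi up_phi lo_lam up_lam)
           (joint_objective m n p A B a w b v) (phi @\<^sub>v lam)"
  shows "is_arg_min (joint_objective m n p A B a w b v)
           (\<lambda>x. x \<in> feasible m n lo_phi up_phi lo_lam up_lam) (phi @\<^sub>v lam)"
proof -
  note A = assms(1) and B = assms(2)
  define X where "X = feasible m n lo_phi up_phi lo_lam up_lam"
  define f where "f = joint_objective m n p A B a w b v"
  define x where "x = phi @\<^sub>v lam"
  define lo where "lo = stacked_entry m lo_phi lo_lam"
  define up where "up = stacked_entry m up_phi up_lam"
  define Y where "Y i = {y. lo i \<le> ereal y \<and> ereal y \<le> up i}" for i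
  define J where "J = {..<m} <+> {..<p}"
  define c where "c = stacked_entry m a b"
  define M where "M = hinge_coeff m A B"
  define u where "u = case_sum (($) w) (($) v)"
  define t where "t j = u j + (\<Sum>i<m + n. M i j * x $ i)" for j
  have X_iff: "z \<in> X \<longleftrightarrow> z \<in> carrier_vec (m + n) \<and> (\<forall>i<m + n. z $ i \<in> Y i)" for z
    by (simp add: X_def in_feasible_iff Y_def lo_def up_def)
  have f_eq: "f z = hinge_objective {..<m + n} J c M u (($) z)" if "z \<in> carrier_vec (m + n)" for z
    unfolding f_def J_def c_def M_def u_def
    by (rule joint_objective_eq_hinge_objective[OF A B that])
  have ilm: "interior_local_min (m + n) X f x"
    using assms(21) by (simp add: X_def f_def x_def)
  then have xX: "x \<in> X" by (simp add: interior_local_min_def)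
  then have x: "x \<in> carrier_vec (m + n)" and xY: "\<And>i. i < m + n \<Longrightarrow> x $ i \<in> Y i"
    by (auto simp: X_iff)
  have convY: "convex (Y i)" for i
    unfolding is_interval_convex_1[symmetric] is_interval_1 Y_def
    by (auto intro: order_trans simp flip: ereal_less_eq(3))
  have finJ: "finite J" by (simp add: J_def)
  have ri: "ri_slopes (Y i) (x $ i)
      (- (dir_slope {..<p} (c i) (t \<circ> Inr) (stacked_row m A B i) (-1)
           + (if i < m then dirderiv_pos (t (Inl i)) 1 else 0)))
      (dir_slope {..<p} (c i) (t \<circ> Inr) (stacked_row m A B i) 1
           + (if i < m then dirderiv_pos (t (Inl i)) (-1) else 0))" if i: "i < m + n" for i
  proof -
    have Y: "(x |\<^sub>v i \<mapsto> y) \<in> X \<longleftrightarrow> y \<in> Y i" for y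
      using x xY i by (auto simp: X_iff update_vec_def)
    have upd: "f (x |\<^sub>v i \<mapsto> y) = hinge_objective {..<m + n} J c M u ((($) x)(i := y))" for y
    proof -
      have "x |\<^sub>v i \<mapsto> y \<in> carrier_vec (m + n)" using x by (simp add: update_vec_def)
      then have "f (x |\<^sub>v i \<mapsto> y) = hinge_objective {..<m + n} J c M u (($) (x |\<^sub>v i \<mapsto> y))"
        by (rule f_eq)
      also have "\<dots> = hinge_objective {..<m + n} J c M u ((($) x)(i := y))"
        using x by (intro hinge_objective_cong) (auto simp: update_vec_def)
      finally show ?thesis .
    qed
    have "x $ i \<in> rel_interior (argmin_set (\<lambda>y. extended X f (x |\<^sub>v i \<mapsto> y)))"
      using ilm i by (simp add: interior_local_min_def)
    also have "argmin_set (\<lambda>y. extended X f (x |\<^sub>v i \<mapsto> y)) =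
        {y \<in> Y i. \<forall>y'\<in>Y i. f (x |\<^sub>v i \<mapsto> y) \<le> f (x |\<^sub>v i \<mapsto> y')}"
      using x i by (intro argmin_set_extended xX Y) auto
    finally have "ri_slopes (Y i) (x $ i) (- dir_slope J (c i) t (M i) (-1))
        (dir_slope J (c i) t (M i) 1)"
      unfolding upd t_def using i
      by (intro hinge_objective_ri_slopes finJ convY) auto
    then show ?thesis
      unfolding J_def M_def dir_slope_hinge_coeff by (cases "i < m") simp_all
  qed
  have row: "stacked_row m A B i j \<in> {-1, 0, 1}" if "i < m + n" "j < p" for i j
  proof (cases "i < m")
    case True
    then have "A $$ (i, j) \<in> elements_mat A" using elements_matI[OF A] that by blast
    then show ?thesis using True assms(13) by (auto simp: stacked_row_def)
  next
    case False
    then have "i - m < n" using that by simp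
    then have "B $$ (i - m, j) \<in> elements_mat B" using elements_matI[OF B] that by blast
    then show ?thesis using False assms(15) by (auto simp: stacked_row_def)
  qed
  have rowZ: "\<forall>j\<in>{..<p}. stacked_row m A B i j \<in> \<int>" if "i < m + n" for i
    using row[OF that] by fastforce
  have row2: "(\<Sum>j<p. \<bar>stacked_row m A B i j\<bar>) \<le> 2" if i: "i < m + n" for i
  proof -
    have "card {j. j < p \<and> stacked_row m A B i j \<noteq> 0} \<le> 2"
      using assms(14,16) i by (cases "i < m") (auto simp: stacked_row_def)
    then show ?thesis
      using sum_abs_le_card_support[of p "stacked_row m A B i"] row[OF i] by force
  qed
  let ?h = "\<lambda>i. \<Sum>j<p. stacked_row m A B i j * mid_subgrad (t (Inr j))"
  have "\<exists>q \<in> subgrad_pos (t (Inl i)). stationary (Y i) (x $ i) (c i - q + ?h i)"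
    if i: "i < m" for i
  proof -
    have im: "i < m + n" using i by simp
    have "c i \<in> \<int> \<or> c i \<le> -2 \<or> c i \<ge> 3"
      using assms(17) i by (force simp: c_def stacked_entry_def)
    from exists_stationary_mid_subgrad[OF finite_lessThan rowZ[OF im] row2[OF im] this,
        where t = "t \<circ> Inr" and u = "t (Inl i)"] ri[OF im] i
    show ?thesis by simp
  qed
  \<comment> \<open>The choices for different \<open>i\<close> cannot conflict, since the term
    \<open>Inl i\<close> has a non-zero coefficient only in coordinate \<open>i\<close>.\<close>
  then obtain r where r: "\<And>i. i < m \<Longrightarrow> r i \<in> subgrad_pos (t (Inl i))"
      "\<And>i. i < m \<Longrightarrow> stationary (Y i) (x $ i) (c i - r i + ?h i)"
    by metis
  \<comment> \<open>The certificate: adjustable weights for the terms \<open>Inl i\<close>, the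
    fixed midpoint rule for the terms shared between coordinates.\<close>
  define q where "q = case_sum r (\<lambda>j. mid_subgrad (t (Inr j)))"
  have "stationary (Y i) (x $ i) (c i + (\<Sum>j\<in>J. M i j * q j))" if i: "i < m + n" for i
  proof -
    have "(\<Sum>k<m. M i (Inl k) * r k) = (\<Sum>k<m. if k = i then - r k else 0)"
      by (intro sum.cong) (auto simp: M_def hinge_coeff_def)
    also have "\<dots> = (if i < m then - r i else 0)" by simp
    finally have eq: "(\<Sum>j\<in>J. M i j * q j) = (if i < m then - r i else 0) + ?h i"
      by (simp add: J_def sum.Plus q_def) (simp add: M_def hinge_coeff_def)
    show ?thesis
    proof (cases "i < m")
      case True
      then show ?thesis using r(2)[OF True] True unfolding eq by (simp add: algebra_simps)
    next
      case False
      then have "b $ (i - m) \<in> {..-2} \<union> {-1, 0, 1} \<union> {2..}"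
        using assms(18) i by auto
      then have "c i \<in> \<int> \<or> c i \<le> -2 \<or> c i \<ge> 2"
        using False by (auto simp: c_def stacked_entry_def)
      from stationary_mid_subgrad[OF finite_lessThan rowZ[OF i] row2[OF i] this,
          where t = "t \<circ> Inr"] ri[OF i] False
      show ?thesis by (simp add: eq)
    qed
  qed
  moreover have "q j \<in> subgrad_pos (u j + (\<Sum>i<m + n. M i j * x $ i))" if "j \<in> J" for j
    using that r(1) unfolding t_def[symmetric] by (auto simp: J_def q_def mid_subgrad_in)
  ultimately have "hinge_objective {..<m + n} J c M u (($) x)
      \<le> hinge_objective {..<m + n} J c M u (($) z)" if "z \<in> X" for z
    using that by (intro hinge_objective_global_min[where X = Y and q = q]) (auto simp: X_iff)
  then have "f x \<le> f z" if "z \<in> X" for z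
    using that x by (simp add: f_eq X_iff)
  then show ?thesis
    using xX by (auto simp: is_arg_min_def X_def f_def x_def not_less)
qed

end
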